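(* For all integers $k\ge 3$ and $n\ge 1$, the minimum number of moves required to solve the generalized Towers of Hanoi problem with $n$ discs and $k$ pegs is $2S(n-1,k,k-2)+1$; that is, $T(n,k)=2S(n-1,k,k-2)+1$.
   Context: Generalized Towers of Hanoi puzzle: there are $k$ pegs and $n$ discs of pairwise distinct sizes. A legal position assigns each disc to a peg; the discs on each peg are stacked in order of size with the largest at the bottom. A move takes the topmost (smallest) disc of one peg and places it on a different peg that is empty or whose topmost disc is larger than the moved disc. Initially all $n$ discs are on one peg (the source) and the other $k-1$ pegs are empty; the problem is to transfer all discs to one given other peg. $S(n,k,m)$ denotes the minimum number of moves required to distribute a single tower consisting of $n$ discs onto $m$ empty pegs with $k$ pegs available: starting with all $n$ discs on the source peg, reach a position in which every disc lies on one of $m$ given pegs other than the source (some of these may remain empty). $S(0,k,m)=0$. $T(n,k)=S(n,k,1)$ is the minimum number of moves needed to transfer the tower to one given peg. *)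

theory Defs
  imports Main "HOL-Library.FuncSet"
begin

text \<open>
  Discs are the numbers \<open>0, \<dots>, n - 1\<close>, ordered by size (\<open>0\<close> is the smallest disc); pegs are the
  numbers \<open>0, \<dots>, k - 1\<close>. As the stacking order on each peg is forced, a legal position is just a
  function from discs to pegs.
\<close>

definition positions :: "nat \<Rightarrow> nat \<Rightarrow> (nat \<Rightarrow> nat) set" where
  "positions n k = {..<n} \<rightarrow>\<^sub>E {..<k}"

definition topmost :: "nat \<Rightarrow> (nat \<Rightarrow> nat) \<Rightarrow> nat \<Rightarrow> nat \<Rightarrow> bool" where
  "topmost n f p d \<longleftrightarrow> d < n \<and> f d = p \<and> (\<forall>e<n. f e = p \<longrightarrow> d \<le> e)"

definition moves :: "nat \<Rightarrow> nat \<Rightarrow> ((nat \<Rightarrow> nat) \<times> (nat \<Rightarrow> nat)) set" where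
  "moves n k = {(f, f(d := q)) | f d p q.
     f \<in> positions n k \<and> p < k \<and> q < k \<and> p \<noteq> q \<and> topmost n f p d \<and>
     ((\<forall>e<n. f e \<noteq> q) \<or> (\<exists>e. topmost n f q e \<and> d < e))}"

definition tower :: "nat \<Rightarrow> nat \<Rightarrow> nat \<Rightarrow> nat" where
  "tower n s = (\<lambda>d\<in>{..<n}. s)"

definition distributable :: "nat \<Rightarrow> nat \<Rightarrow> nat \<Rightarrow> nat set \<Rightarrow> nat \<Rightarrow> bool" where
  "distributable n k s A r \<longleftrightarrow> (\<exists>g. (tower n s, g) \<in> moves n k ^^ r \<and> (\<forall>d<n. g d \<in> A))"

definition min_moves :: "nat \<Rightarrow> nat \<Rightarrow> nat \<Rightarrow> nat set \<Rightarrow> nat" where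
  "min_moves n k s A = (LEAST r. distributable n k s A r)"

text \<open>
  The source is peg \<open>0\<close> and the \<open>m\<close> given pegs are \<open>1, \<dots>, m\<close>, which makes sense for \<open>m < k\<close>.
  By \<open>min_moves_eq_hanoi_S\<close> below the choice of pegs is irrelevant, and by \<open>distributable_ex\<close>
  the minimum is over a nonempty set for \<open>k \<ge> 3\<close> and \<open>m \<ge> 1\<close>.
\<close>

definition hanoi_S :: "nat \<Rightarrow> nat \<Rightarrow> nat \<Rightarrow> nat" where
  "hanoi_S n k m = min_moves n k 0 {1..m}"

definition hanoi_T :: "nat \<Rightarrow> nat \<Rightarrow> nat" where
  "hanoi_T n k = hanoi_S n k 1"

lemma hanoi_S_0: "hanoi_S 0 k m = 0"
  unfolding hanoi_S_def min_moves_def distributable_def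
  by (rule Least_eq_0) simp

lemma topmost_ex:
  assumes "e < n" "f e = q"
  shows "\<exists>e. topmost n f q e"
proof -
  let ?e = "LEAST e. e < n \<and> f e = q"
  have "?e < n \<and> f ?e = q" by (rule LeastI[of _ e]) (use assms in simp)
  moreover have "\<forall>i<n. f i = q \<longrightarrow> ?e \<le> i" by (auto intro: Least_le)
  ultimately show ?thesis unfolding topmost_def by blast
qed

lemma moves_iff:
  "(f, g) \<in> moves n k \<longleftrightarrow>
     f \<in> positions n k \<and>
     (\<exists>d<n. \<exists>q<k. g = f(d := q) \<and> q \<noteq> f d \<and> (\<forall>e<d. f e \<noteq> f d \<and> f e \<noteq> q))"
  (is "?L \<longleftrightarrow> ?R")
proof
  assume ?L
  then obtain d p q where *: "f \<in> positions n k" "q < k" "p \<noteq> q" "topmost n f p d" "g = f(d := q)"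
    "(\<forall>e<n. f e \<noteq> q) \<or> (\<exists>e. topmost n f q e \<and> d < e)"
    unfolding moves_def by blast
  have d: "d < n" "f d = p" using *(4) by (auto simp: topmost_def)
  have "f e \<noteq> f d \<and> f e \<noteq> q" if "e < d" for e
  proof -
    have e: "e < n" using that d by simp
    then have "f e = p \<Longrightarrow> d \<le> e" using *(4) by (simp add: topmost_def)
    then have 1: "f e \<noteq> p" using that by auto
    from *(6) have "f e \<noteq> q"
    proof
      assume "\<exists>e'. topmost n f q e' \<and> d < e'"
      then obtain e' where e': "topmost n f q e'" "d < e'" by blast
      show "f e \<noteq> q"
      proof
        assume "f e = q"
        then have "e' \<le> e" using e' e by (simp add: topmost_def)
        then show False using e' that by simp
      qed
    qed (use e in simp)
    then show ?thesis using 1 d by simp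
  qed
  then show ?R using * d by blast
next
  assume ?R
  then obtain d q where *: "f \<in> positions n k" "d < n" "q < k" "g = f(d := q)" "q \<noteq> f d"
    "\<And>e. e < d \<Longrightarrow> f e \<noteq> f d \<and> f e \<noteq> q" by blast
  have p: "f d < k" using *(1,2) by (auto simp: positions_def)
  have t: "topmost n f (f d) d" using * by (auto simp: topmost_def not_less[symmetric])
  have "(\<forall>e<n. f e \<noteq> q) \<or> (\<exists>e. topmost n f q e \<and> d < e)"
  proof (cases "\<forall>e<n. f e \<noteq> q")
    case False
    then obtain e where e: "topmost n f q e" using topmost_ex by blast
    then have "f e = q" by (simp add: topmost_def)
    then have "d < e" using *(5,6) by (metis linorder_neqE_nat)
    then show ?thesis using e by blast
  qed simp
  then show ?L using * p t unfolding moves_def by blast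
qed

lemma movesI:
  assumes "f \<in> positions n k" "d < n" "q < k" "g = f(d := q)" "q \<noteq> f d"
    "\<And>e. e < d \<Longrightarrow> f e \<noteq> f d \<and> f e \<noteq> q"
  shows "(f, g) \<in> moves n k"
  unfolding moves_iff using assms by blast

lemma moves_rename:
  assumes "inj_on h {..<k}" "h ` {..<k} \<subseteq> {..<k}" "(f, g) \<in> moves n k"
  shows "(restrict (h \<circ> f) {..<n}, restrict (h \<circ> g) {..<n}) \<in> moves n k"
proof -
  obtain d q where *: "f \<in> positions n k" "d < n" "q < k" "g = f(d := q)" "q \<noteq> f d"
    "\<And>e. e < d \<Longrightarrow> f e \<noteq> f d \<and> f e \<noteq> q" using assms(3) unfolding moves_iff by blast
  have f: "f e < k" if "e < n" for e using *(1) that by (auto simp: positions_def)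
  have h: "h x = h y \<longleftrightarrow> x = y" if "x < k" "y < k" for x y
    using assms(1) that by (auto simp: inj_on_def)
  have hk: "h x < k" if "x < k" for x using assms(2) that by auto
  show ?thesis
  proof (rule movesI[of _ _ _ d "h q"])
    show "restrict (h \<circ> f) {..<n} \<in> positions n k" using f hk by (auto simp: positions_def)
    show "restrict (h \<circ> g) {..<n} = (restrict (h \<circ> f) {..<n})(d := h q)"
      using *(2) unfolding *(4) by (auto simp: fun_eq_iff)
    show "h q \<noteq> restrict (h \<circ> f) {..<n} d"
      using h[OF *(3) f[OF *(2)]] *(2,5) by simp
  next
    fix e assume e: "e < d"
    then have en: "e < n" using *(2) by simp
    show "restrict (h \<circ> f) {..<n} e \<noteq> restrict (h \<circ> f) {..<n} d \<and>
      restrict (h \<circ> f) {..<n} e \<noteq> h q"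
      using h[OF f[OF en] f[OF *(2)]] h[OF f[OF en] *(3)] *(6)[OF e] en *(2) by simp
  qed (use *(2) hk[OF *(3)] in auto)
qed

lemma relpow_map:
  assumes "\<And>x y. (x, y) \<in> R \<Longrightarrow> (F x, F y) \<in> Q" "(x, y) \<in> R ^^ r"
  shows "(F x, F y) \<in> Q ^^ r"
  using assms(2) by (induction r arbitrary: y) (auto intro: assms(1))

lemma distributable_rename:
  assumes "s < k" "A \<subseteq> {..<k} - {s}" "s' < k" "A' \<subseteq> {..<k} - {s'}" "card A = card A'"
    and "distributable n k s A r"
  shows "distributable n k s' A' r"
proof -
  have fin: "finite A" "finite A'" using assms finite_subset by (metis finite_Diff finite_lessThan)+
  obtain h1 where h1: "bij_betw h1 A A'" using fin assms(5) finite_same_card_bij by blast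
  let ?B = "{..<k} - insert s A" and ?B' = "{..<k} - insert s' A'"
  have "card ?B = k - card (insert s A)"
    using assms fin by (subst card_Diff_subset) auto
  moreover have "card ?B' = k - card (insert s' A')"
    using assms fin by (subst card_Diff_subset) auto
  moreover have "card (insert s A) = card (insert s' A')"
  proof -
    have "s \<notin> A" "s' \<notin> A'" using assms by auto
    then show ?thesis using fin assms(5) by simp
  qed
  ultimately have "card ?B = card ?B'" by simp
  then obtain h2 where h2: "bij_betw h2 ?B ?B'" using finite_same_card_bij by blast
  define h where "h x = (if x = s then s' else if x \<in> A then h1 x else h2 x)" for x
  have 1: "bij_betw h A A'" using h1 assms(2) by (subst bij_betw_cong[of _ _ h1]) (auto simp: h_def)
  have 2: "bij_betw h ?B ?B'" using h2 by (subst bij_betw_cong[of _ _ h2]) (auto simp: h_def)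
  have 3: "bij_betw h {s} {s'}" by (simp add: h_def)
  have "bij_betw h ({s} \<union> A \<union> ?B) ({s'} \<union> A' \<union> ?B')"
    using assms by (intro bij_betw_combine 1 2 3) auto
  moreover have "{s} \<union> A \<union> ?B = {..<k}" "{s'} \<union> A' \<union> ?B' = {..<k}" using assms by auto
  ultimately have h: "bij_betw h {..<k} {..<k}" by simp
  obtain g where g: "(tower n s, g) \<in> moves n k ^^ r" "\<forall>d<n. g d \<in> A"
    using assms(6) by (auto simp: distributable_def)
  have "(restrict (h \<circ> tower n s) {..<n}, restrict (h \<circ> g) {..<n}) \<in> moves n k ^^ r"
    by (rule relpow_map[OF moves_rename g(1)]) (use h in \<open>auto simp: bij_betw_def\<close>)
  moreover have "restrict (h \<circ> tower n s) {..<n} = tower n s'"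
    by (auto simp: tower_def h_def fun_eq_iff)
  moreover have "\<forall>d<n. restrict (h \<circ> g) {..<n} d \<in> A'"
    using g(2) 1 by (auto simp: bij_betw_def)
  ultimately show ?thesis unfolding distributable_def by auto
qed

lemma min_moves_eq_hanoi_S:
  assumes "s < k" "A \<subseteq> {..<k} - {s}"
  shows "min_moves n k s A = hanoi_S n k (card A)"
proof -
  have "card A \<le> card ({..<k} - {s})" using assms(2) by (intro card_mono) auto
  then have "card A < k" using assms(1) by simp
  then have B: "{1..card A} \<subseteq> {..<k} - {0}" and k: "0 < k" by auto
  have c: "card A = card {1..card A}" by simp
  have "distributable n k s A = distributable n k 0 {1..card A}"
    using distributable_rename[OF assms k B c] distributable_rename[OF k B assms c[symmetric]]
    by (intro ext iffI)
  then show ?thesis by (simp add: hanoi_S_def min_moves_def)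
qed

lemma moves_extend:
  assumes "(f, g) \<in> moves n k" "p < k"
  shows "(f(n := p), g(n := p)) \<in> moves (Suc n) k"
proof -
  obtain d q where *: "f \<in> positions n k" "d < n" "q < k" "g = f(d := q)" "q \<noteq> f d"
    "\<And>e. e < d \<Longrightarrow> f e \<noteq> f d \<and> f e \<noteq> q" using assms(1) unfolding moves_iff by blast
  show ?thesis
  proof (rule movesI[of _ _ _ d q])
    show "f(n := p) \<in> positions (Suc n) k"
      using *(1) assms(2) by (auto simp: positions_def PiE_iff extensional_def less_Suc_eq)
    show "g(n := p) = (f(n := p))(d := q)" using *(2) unfolding *(4) by (simp add: fun_upd_twist)
    show "q \<noteq> (f(n := p)) d" using *(2,5) by simp
  next
    fix e assume e: "e < d"
    then show "(f(n := p)) e \<noteq> (f(n := p)) d \<and> (f(n := p)) e \<noteq> q"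
      using *(2) *(6)[OF e] by simp
  qed (use *(2,3) in auto)
qed

lemma tower_Suc: "(tower n s)(n := s) = tower (Suc n) s"
  by (auto simp: tower_def fun_eq_iff less_Suc_eq)

lemma tower_transfer:
  assumes "k \<ge> 3" "s < k" "t < k"
  shows "(tower n s, tower n t) \<in> (moves n k)\<^sup>*"
  using assms(2,3)
proof (induction n arbitrary: s t)
  case 0
  show ?case by (simp add: tower_def)
next
  case (Suc n)
  have ext: "(f(n := p), g(n := p)) \<in> (moves (Suc n) k)\<^sup>*"
    if fg: "(f, g) \<in> (moves n k)\<^sup>*" and p: "p < k" for f g p
  proof -
    obtain r where "(f, g) \<in> moves n k ^^ r"
      using rtrancl_imp_relpow[OF fg] by (elim exE)
    then have "(f(n := p), g(n := p)) \<in> moves (Suc n) k ^^ r"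
      using relpow_map[where F = "\<lambda>f. f(n := p)" and R = "moves n k" and Q = "moves (Suc n) k",
          OF moves_extend[OF _ p]] by simp
    then show ?thesis by (rule relpow_imp_rtrancl)
  qed
  show ?case
  proof (cases "s = t")
    case False
    have "\<exists>u<3. u \<noteq> s \<and> u \<noteq> t" by presburger
    then obtain u where u: "u < k" "u \<noteq> s" "u \<noteq> t" using assms(1) by (meson less_le_trans)
    have "(tower (Suc n) s, (tower n u)(n := s)) \<in> (moves (Suc n) k)\<^sup>*"
      using ext[OF Suc.IH[OF Suc.prems(1) u(1)] Suc.prems(1)] unfolding tower_Suc .
    moreover have "((tower n u)(n := s), (tower n u)(n := t)) \<in> moves (Suc n) k"
    proof (rule movesI[of _ _ _ n t])
      show "(tower n u)(n := s) \<in> positions (Suc n) k"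
        using Suc.prems u by (auto simp: positions_def PiE_iff extensional_def less_Suc_eq tower_def)
      show "(tower n u)(n := t) = (tower n u)(n := s, n := t)" by simp
    qed (use Suc.prems u False in \<open>simp_all add: tower_def\<close>)
    moreover have "((tower n u)(n := t), tower (Suc n) t) \<in> (moves (Suc n) k)\<^sup>*"
      using ext[OF Suc.IH[OF u(1) Suc.prems(2)] Suc.prems(2)] unfolding tower_Suc .
    ultimately show ?thesis by (rule rtrancl_trans[OF rtrancl.rtrancl_into_rtrancl])
  qed simp
qed

lemma distributable_ex:
  assumes "k \<ge> 3" "s < k" "A \<subseteq> {..<k}" "A \<noteq> {}"
  shows "\<exists>r. distributable n k s A r"
proof -
  obtain t where t: "t \<in> A" "t < k" using assms by auto
  obtain r where "(tower n s, tower n t) \<in> moves n k ^^ r"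
    using rtrancl_imp_relpow[OF tower_transfer[OF assms(1,2) t(2), of n]] by (elim exE)
  moreover have "\<forall>d<n. tower n t d \<in> A" using t by (simp add: tower_def)
  ultimately show ?thesis unfolding distributable_def by blast
qed

end

theory Submission
  imports Defs
begin

text \<open>
  Everything hinges on the largest disc. When it moves, from a peg \<open>p\<close> to a peg \<open>q\<close>, no smaller disc
  lies on \<open>p\<close> or on \<open>q\<close>, so the smaller discs are spread over the other \<open>k - 2\<close> pegs.

  \<^emph>\<open>Lower bound.\<close> Up to the first move of the largest disc, the smaller discs have been distributed
  from the source onto \<open>k - 2\<close> pegs, which takes at least \<open>S(n - 1, k, k - 2)\<close> moves of smaller discs
  (\<open>first_largest_move\<close>). Since moves are reversible, the same lemma applies to the solution read
  backwards: after the last move of the largest disc there are again at least \<open>S(n - 1, k, k - 2)\<close>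
  moves. The first and the last move of the largest disc may coincide, so only one further move is
  certain.

  \<^emph>\<open>Upper bound.\<close> An optimal distribution of the smaller discs avoiding the source and the target
  is turned, by exchanging these two pegs, into a distribution of the tower standing on the target
  that ends in the very same position. Its reverse therefore completes the solution once the largest
  disc has moved from the source to the target.
\<close>

lemma relpow_sym:
  assumes "sym R" "(x, y) \<in> R ^^ r"
  shows "(y, x) \<in> R ^^ r"
  using assms(2)
proof (induction r arbitrary: y)
  case (Suc r)
  then obtain z where "(x, z) \<in> R ^^ r" "(z, y) \<in> R" by auto
  then show ?case using Suc.IH symD[OF assms(1)] by (blast intro: relpow_Suc_I2)
qed simp

lemma relpow_first_exit:
  assumes "(x, y) \<in> R ^^ r" "P x" "\<not> P y"
  shows "\<exists>a b u v. r = a + Suc b \<and> (x, u) \<in> (R \<inter> {(x, y). P x \<and> P y}) ^^ a \<and> P u \<and>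
    (u, v) \<in> R \<and> \<not> P v \<and> (v, y) \<in> R ^^ b"
  using assms(1,2)
proof (induction r arbitrary: x)
  case 0
  then show ?case using assms(3) by simp
next
  case (Suc r)
  obtain z where z: "(x, z) \<in> R" "(z, y) \<in> R ^^ r" using relpow_Suc_D2[OF Suc.prems(1)] by blast
  show ?case
  proof (cases "P z")
    case True
    obtain a b u v where *: "r = a + Suc b" "(z, u) \<in> (R \<inter> {(x, y). P x \<and> P y}) ^^ a" "P u"
      "(u, v) \<in> R" "\<not> P v" "(v, y) \<in> R ^^ b" using Suc.IH[OF z(2) True] by blast
    have "(x, u) \<in> (R \<inter> {(x, y). P x \<and> P y}) ^^ Suc a"
      using z(1) True Suc.prems(2) by (intro relpow_Suc_I2[OF _ *(2)]) auto
    then show ?thesis using * by (intro exI[of _ "Suc a"] exI[of _ b] exI[of _ u] exI[of _ v]) auto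
  next
    case False
    then show ?thesis using z Suc.prems(2)
      by (intro exI[of _ 0] exI[of _ r] exI[of _ x] exI[of _ z]) auto
  qed
qed

lemma moves_in_positions:
  assumes "(f, g) \<in> moves n k"
  shows "g \<in> positions n k"
  using assms by (auto simp: moves_iff positions_def PiE_iff extensional_def)

lemma relpow_moves_in_positions:
  assumes "(f, g) \<in> moves n k ^^ r" "f \<in> positions n k"
  shows "g \<in> positions n k"
  using assms by (cases r) (auto intro: moves_in_positions)

lemma tower_in_positions: "s < k \<Longrightarrow> tower n s \<in> positions n k"
  by (auto simp: tower_def positions_def)

lemma sym_moves: "sym (moves n k)"
proof (rule symI)
  fix f g assume fg: "(f, g) \<in> moves n k"
  then obtain d q where *: "f \<in> positions n k" "d < n" "q < k" "g = f(d := q)" "q \<noteq> f d"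
    "\<And>e. e < d \<Longrightarrow> f e \<noteq> f d \<and> f e \<noteq> q" unfolding moves_iff by blast
  have "f d < k" using *(1,2) by (auto simp: positions_def)
  then show "(g, f) \<in> moves n k"
    using * by (intro movesI[OF moves_in_positions[OF fg], of d "f d"]) auto
qed

lemma moves_forget_largest:
  assumes "(f, g) \<in> moves (Suc n) k" "f n = g n"
  shows "(restrict f {..<n}, restrict g {..<n}) \<in> moves n k"
proof -
  obtain d q where *: "f \<in> positions (Suc n) k" "d < Suc n" "q < k" "g = f(d := q)" "q \<noteq> f d"
    "\<And>e. e < d \<Longrightarrow> f e \<noteq> f d \<and> f e \<noteq> q" using assms(1) unfolding moves_iff by blast
  have d: "d < n" using *(2,4,5) assms(2) by (cases "d = n") auto
  show ?thesis
  proof (rule movesI[of _ _ _ d q])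
    show "restrict f {..<n} \<in> positions n k" using *(1) by (simp add: positions_def PiE_iff)
    show "restrict g {..<n} = (restrict f {..<n})(d := q)"
    proof
      fix e
      show "restrict g {..<n} e = ((restrict f {..<n})(d := q)) e"
        using d unfolding *(4) by (cases "e = d") simp_all
    qed
  next
    fix e assume e: "e < d"
    show "restrict f {..<n} e \<noteq> restrict f {..<n} d \<and> restrict f {..<n} e \<noteq> q"
      using *(6)[OF e] e d by simp
  qed (use *(3,5) d in simp_all)
qed

text \<open>
  When the largest disc leaves peg \<open>s\<close> for a peg \<open>q\<close>, the smaller discs avoid both pegs; forgetting
  the largest disc, the moves made so far thus distribute a tower onto the \<open>k - 2\<close> remaining pegs.
  The rest of the sequence, \<open>Suc b\<close> moves from \<open>u\<close> on, includes the first move of the largest disc: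
  this way the lemma can be applied once more to the reverse of the rest, even if the largest disc
  moves only once.
\<close>

lemma first_largest_move:
  assumes "(tower (Suc n) s, g) \<in> moves (Suc n) k ^^ r" "s < k" "g n \<noteq> s"
  shows "\<exists>a b u. r = a + Suc b \<and> hanoi_S n k (k - 2) \<le> a \<and> u n = s \<and>
    (u, g) \<in> moves (Suc n) k ^^ Suc b"
proof -
  let ?R = "moves (Suc n) k" and ?stay = "{(f, g). f n = s \<and> g n = s}"
  have "tower (Suc n) s n = s" by (simp add: tower_def)
  then obtain a b u v where *: "r = a + Suc b"
    "(tower (Suc n) s, u) \<in> (?R \<inter> ?stay) ^^ a" "u n = s" "(u, v) \<in> ?R" "v n \<noteq> s" "(v, g) \<in> ?R ^^ b"
    using relpow_first_exit[where R = ?R and P = "\<lambda>f. f n = s", OF assms(1) _ assms(3)] by blast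
  obtain d q where d: "u \<in> positions (Suc n) k" "d < Suc n" "q < k" "v = u(d := q)" "q \<noteq> u d"
    "\<And>e. e < d \<Longrightarrow> u e \<noteq> u d \<and> u e \<noteq> q" using *(4) unfolding moves_iff by blast
  have dn: "d = n" using d(4) *(3,5) by (metis fun_upd_other)
  let ?A = "{..<k} - {s, q}"
  have qs: "q \<noteq> s" using d(5) *(3) dn by simp
  have "(restrict (tower (Suc n) s) {..<n}, restrict u {..<n}) \<in> moves n k ^^ a"
    by (rule relpow_map[where F = "\<lambda>f. restrict f {..<n}", OF _ *(2)])
      (auto intro: moves_forget_largest)
  moreover have "restrict (tower (Suc n) s) {..<n} = tower n s"
    by (auto simp: tower_def fun_eq_iff)
  moreover have "restrict u {..<n} e \<in> ?A" if "e < n" for e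
  proof -
    have "u e < k" using that d(1) by (simp add: positions_def PiE_iff)
    then show ?thesis using that d(6)[of e] dn *(3) by simp
  qed
  ultimately have "distributable n k s ?A a" unfolding distributable_def by metis
  then have "min_moves n k s ?A \<le> a" unfolding min_moves_def by (rule Least_le)
  moreover have "card ?A = k - 2"
    using assms(2) d(3) qs by (subst card_Diff_subset) auto
  moreover have "min_moves n k s ?A = hanoi_S n k (card ?A)"
    by (rule min_moves_eq_hanoi_S) (use assms(2) in auto)
  ultimately have "hanoi_S n k (k - 2) \<le> a" by simp
  then show ?thesis using *(1,3) relpow_Suc_I2[OF *(4,6)] by blast
qed

lemma transfer_lower_bound:
  assumes "(tower (Suc n) s, tower (Suc n) t) \<in> moves (Suc n) k ^^ r" "s < k" "t < k" "s \<noteq> t"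
  shows "2 * hanoi_S n k (k - 2) + 1 \<le> r"
proof -
  have top: "tower (Suc n) t n = t" by (simp add: tower_def)
  obtain a b u where 1: "r = a + Suc b" "hanoi_S n k (k - 2) \<le> a" "u n = s"
    "(u, tower (Suc n) t) \<in> moves (Suc n) k ^^ Suc b"
    using first_largest_move[OF assms(1,2)] top assms(4) by auto
  obtain a' b' where "Suc b = a' + Suc b'" "hanoi_S n k (k - 2) \<le> a'"
    using first_largest_move[OF relpow_sym[OF sym_moves 1(4)] assms(3)] 1(3) assms(4) by auto
  then show ?thesis using 1(1,2) by simp
qed

lemma transfer_upper_bound:
  assumes "k \<ge> 3"
  shows "(tower (Suc n) 0, tower (Suc n) 1) \<in> moves (Suc n) k ^^ (2 * hanoi_S n k (k - 2) + 1)"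
proof -
  let ?S = "hanoi_S n k (k - 2)"
  have "hanoi_S n k (card {2..<k}) = min_moves n k 0 {2..<k}"
    by (rule min_moves_eq_hanoi_S[symmetric]) (use assms in auto)
  then have "?S = min_moves n k 0 {2..<k}" by simp
  moreover have "\<exists>r. distributable n k 0 {2..<k} r"
    by (rule distributable_ex) (use assms in auto)
  ultimately have "distributable n k 0 {2..<k} ?S"
    using LeastI_ex[of "distributable n k 0 {2..<k}"] by (simp add: min_moves_def)
  then obtain g where g: "(tower n 0, g) \<in> moves n k ^^ ?S" "\<And>d. d < n \<Longrightarrow> g d \<in> {2..<k}"
    unfolding distributable_def by blast
  have pos: "g \<in> positions n k"
    using relpow_moves_in_positions[OF g(1)] tower_in_positions assms by simp
  define h :: "nat \<Rightarrow> nat" where "h = id(0 := 1, 1 := 0)"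
  have h: "inj_on h {..<k}" "h ` {..<k} \<subseteq> {..<k}"
    using assms by (auto simp: h_def inj_on_def)
  have hg: "restrict (h \<circ> g) {..<n} = g"
  proof
    fix d
    show "restrict (h \<circ> g) {..<n} d = g d"
      using g(2)[of d] pos by (cases "d < n") (auto simp: h_def positions_def PiE_iff extensional_def)
  qed
  have ht: "restrict (h \<circ> tower n 0) {..<n} = tower n 1"
    by (auto simp: tower_def h_def fun_eq_iff)
  have "(tower n 1, g) \<in> moves n k ^^ ?S"
    using relpow_map[where F = "\<lambda>f. restrict (h \<circ> f) {..<n}", OF moves_rename[OF h] g(1)]
    unfolding ht hg .
  then have return: "(g, tower n 1) \<in> moves n k ^^ ?S" by (rule relpow_sym[OF sym_moves])
  have ext: "(f(n := p), f'(n := p)) \<in> moves (Suc n) k ^^ r"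
    if "(f, f') \<in> moves n k ^^ r" "p < k" for f f' p r
    using relpow_map[where F = "\<lambda>f. f(n := p)", OF moves_extend[OF _ that(2)] that(1)] .
  have "(tower (Suc n) 0, g(n := 0)) \<in> moves (Suc n) k ^^ ?S"
    using ext[OF g(1), of 0] assms unfolding tower_Suc by simp
  moreover have "(g(n := 0), g(n := 1)) \<in> moves (Suc n) k"
  proof (rule movesI[of _ _ _ n 1])
    show "g(n := 0) \<in> positions (Suc n) k"
      using pos assms by (auto simp: positions_def PiE_iff extensional_def less_Suc_eq)
  next
    fix e assume "e < n"
    then show "(g(n := 0)) e \<noteq> (g(n := 0)) n \<and> (g(n := 0)) e \<noteq> 1" using g(2)[of e] by auto
  qed (use assms in auto)
  moreover have "(g(n := 1), tower (Suc n) 1) \<in> moves (Suc n) k ^^ ?S"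
    using ext[OF return, of 1] assms unfolding tower_Suc by simp
  ultimately have "(tower (Suc n) 0, tower (Suc n) 1) \<in> moves (Suc n) k ^^ (Suc ?S + ?S)"
    unfolding relpow_add by (meson relcompI relpow_Suc_I)
  moreover have "Suc ?S + ?S = 2 * ?S + 1" by simp
  ultimately show ?thesis by (simp only:)
qed

theorem mainTheorem3:
  fixes k n :: nat
  assumes "k \<ge> 3" and "n \<ge> 1"
  shows "hanoi_T n k = 2 * hanoi_S (n - 1) k (k - 2) + 1"
proof -
  obtain m where n: "n = Suc m" using assms(2) by (cases n) auto
  have transfer: "distributable n k 0 {1..1} r \<longleftrightarrow> (tower n 0, tower n 1) \<in> moves n k ^^ r" for r
  proof
    assume "distributable n k 0 {1..1} r"
    then obtain g where g: "(tower n 0, g) \<in> moves n k ^^ r" "\<forall>d<n. g d = 1"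
      unfolding distributable_def by auto
    then have "g \<in> positions n k"
      using relpow_moves_in_positions tower_in_positions assms(1) by simp
    then have "g = tower n 1"
      using g(2) by (auto simp: fun_eq_iff tower_def positions_def PiE_iff extensional_def)
    then show "(tower n 0, tower n 1) \<in> moves n k ^^ r" using g(1) by simp
  next
    assume "(tower n 0, tower n 1) \<in> moves n k ^^ r"
    then show "distributable n k 0 {1..1} r" unfolding distributable_def by (auto simp: tower_def)
  qed
  have "hanoi_T n k = (LEAST r. (tower n 0, tower n 1) \<in> moves n k ^^ r)"
    unfolding hanoi_T_def hanoi_S_def min_moves_def transfer ..
  also have "\<dots> = 2 * hanoi_S m k (k - 2) + 1"
  proof (rule Least_equality)
    show "(tower n 0, tower n 1) \<in> moves n k ^^ (2 * hanoi_S m k (k - 2) + 1)"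
      unfolding n by (rule transfer_upper_bound[OF assms(1)])
  next
    fix r assume "(tower n 0, tower n 1) \<in> moves n k ^^ r"
    then show "2 * hanoi_S m k (k - 2) + 1 \<le> r"
      unfolding n by (rule transfer_lower_bound) (use assms(1) in auto)
  qed
  finally show ?thesis by (simp add: n)
qed

end
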